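(* For every constant $c$ and every $\varepsilon>0$ there is $N$ such that the following holds. Let $G$ be an $\frac n2$-regular graph on $n\ge N$ vertices whose second largest adjacency eigenvalue satisfies $\lambda_2\le c$. Then there is a labeling of the vertices of $G$ and of $K_{n/2,n/2}$ by the same set such that $|E(G)\,\triangle\,E(K_{n/2,n/2})|\le\varepsilon n^2$. (In words: every $\frac n2$-regular graph with bounded second eigenvalue is close to $K_{n/2,n/2}$, i.e. differs from it in $o(n^2)$ edges.)
   Context: Eigenvalues of a graph are those of its adjacency matrix, ordered $\lambda_1\ge\lambda_2\ge\dots\ge\lambda_n$. Two graphs $G,H$ on $n$ vertices are close if there is a labeling of their vertices such that $|E(G)\triangle E(H)|=o(n^2)$. *)

theory Defs
  imports
    "Jordan_Normal_Form.Char_Poly"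
    "HOL-Library.Multiset"
begin

locale simple_graph =
  fixes V :: "'a set" and E :: "'a set set"
  assumes finite_vertices: "finite V"
    and edges_subset: "E \<subseteq> {e. e \<subseteq> V \<and> card e = 2}"

definition degree_in :: "'a set set \<Rightarrow> 'a \<Rightarrow> nat" where
  "degree_in E v = card {e \<in> E. v \<in> e}"

definition regular_graph :: "'a set \<Rightarrow> 'a set set \<Rightarrow> nat \<Rightarrow> bool" where
  "regular_graph V E d \<longleftrightarrow> (\<forall>v \<in> V. degree_in E v = d)"

definition adjacency_matrix :: "'a list \<Rightarrow> 'a set set \<Rightarrow> real mat" where
  "adjacency_matrix vs E =
     mat (length vs) (length vs) (\<lambda>(i, j). if {vs ! i, vs ! j} \<in> E then 1 else 0)"

text \<open>The characteristic polynomial does not depend on the order in which the vertices are listed.\<close>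

lemma char_poly_adjacency_matrix_cong:
  assumes "distinct vs" "distinct ws" "set vs = set ws"
    shows "char_poly (adjacency_matrix vs E) = char_poly (adjacency_matrix ws E)"
proof -
  define n where "n = length vs"
  have n': "length ws = n"
    using assms unfolding n_def by (metis distinct_card)
  define P :: "real mat" where "P = mat n n (\<lambda>(i, j). if vs ! i = ws ! j then 1 else 0)"
  define Q :: "real mat" where "Q = mat n n (\<lambda>(i, j). if ws ! i = vs ! j then 1 else 0)"
  let ?A = "adjacency_matrix vs E" and ?B = "adjacency_matrix ws E"
  have "\<forall>i<n. \<exists>k<n. vs ! i = ws ! k"
    using assms(3) n' unfolding n_def by (metis in_set_conv_nth)
  then obtain f where f: "\<And>i. i < n \<Longrightarrow> f i < n \<and> vs ! i = ws ! f i" by metis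
  have "\<forall>i<n. \<exists>k<n. ws ! i = vs ! k"
    using assms(3) n' unfolding n_def by (metis in_set_conv_nth)
  then obtain g where g: "\<And>i. i < n \<Longrightarrow> g i < n \<and> ws ! i = vs ! g i" by metis
  have vi: "\<And>i j. i < n \<Longrightarrow> j < n \<Longrightarrow> vs ! i = vs ! j \<longleftrightarrow> i = j"
    using assms(1) by (simp add: n_def nth_eq_iff_index_eq)
  have wi: "\<And>i j. i < n \<Longrightarrow> j < n \<Longrightarrow> ws ! i = ws ! j \<longleftrightarrow> i = j"
    using assms(2) n' by (simp add: nth_eq_iff_index_eq)
  have P: "P = mat n n (\<lambda>(i, j). if j = f i then 1 else 0)"
    unfolding P_def by (rule eq_matI) (use f wi in auto)
  have Q: "Q = mat n n (\<lambda>(i, j). if j = g i then 1 else 0)"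
    unfolding Q_def by (rule eq_matI) (use g vi in auto)
  have Q': "Q = mat n n (\<lambda>(i, j). if i = f j then 1 else 0)"
    unfolding Q_def by (rule eq_matI) (use f wi in auto)
  have gf: "\<And>i. i < n \<Longrightarrow> g (f i) = i" using f g vi by metis
  have fg: "\<And>i. i < n \<Longrightarrow> f (g i) = i" using f g wi by metis
  have PQ: "P * Q = 1\<^sub>m n"
    unfolding P Q by (rule eq_matI)
      (use f gf in \<open>auto simp: scalar_prod_def if_distrib[of "\<lambda>x. x * _"] sum.delta cong: if_cong\<close>)
  have QP: "Q * P = 1\<^sub>m n"
    unfolding P Q by (rule eq_matI)
      (use g fg in \<open>auto simp: scalar_prod_def if_distrib[of "\<lambda>x. x * _"] sum.delta cong: if_cong\<close>)
  have PB: "P * ?B = mat n n (\<lambda>(i, j). if {vs ! i, ws ! j} \<in> E then 1 else 0)"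
    unfolding P adjacency_matrix_def by (rule eq_matI)
      (use f n' in \<open>auto simp: scalar_prod_def if_distrib[of "\<lambda>x. x * _"] sum.delta cong: if_cong\<close>)
  have A: "?A = P * ?B * Q"
    unfolding PB unfolding Q' adjacency_matrix_def by (rule eq_matI)
      (use f n_def in \<open>auto simp: scalar_prod_def if_distrib[of "\<lambda>x. _ * x"] sum.delta cong: if_cong\<close>)
  have "?A \<in> carrier_mat n n" "?B \<in> carrier_mat n n" "P \<in> carrier_mat n n" "Q \<in> carrier_mat n n"
    using n' by (auto simp: adjacency_matrix_def n_def P Q)
  from similar_mat_witI[OF PQ QP A this] have "similar_mat ?A ?B"
    unfolding similar_mat_def by blast
  then show ?thesis by (rule char_poly_similar)
qed

definition graph_char_poly :: "'a set \<Rightarrow> 'a set set \<Rightarrow> real poly" where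
  "graph_char_poly V E =
     char_poly (adjacency_matrix (SOME vs. distinct vs \<and> set vs = V) E)"

lemma graph_char_poly_eq:
  assumes "distinct vs" "set vs = V"
    shows "graph_char_poly V E = char_poly (adjacency_matrix vs E)"
proof -
  let ?ws = "SOME ws. distinct ws \<and> set ws = V"
  have "distinct ?ws \<and> set ?ws = V"
    by (rule someI[where x = vs]) (use assms in simp)
  with assms show ?thesis
    unfolding graph_char_poly_def by (intro char_poly_adjacency_matrix_cong) auto
qed

text \<open>
  The eigenvalues in weakly decreasing order, repeated according to their algebraic multiplicity.
  As the adjacency matrix is real symmetric, all roots of the characteristic polynomial are real.
\<close>

definition graph_eigenvalues :: "'a set \<Rightarrow> 'a set set \<Rightarrow> real list" where
  "graph_eigenvalues V E = rev (sorted_list_of_multiset (proots (graph_char_poly V E)))"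

text \<open>The index \<open>k\<close> is 1-based; the value is meaningful for \<open>1 \<le> k \<le> card V\<close> only.\<close>

definition graph_eigenvalue :: "'a set \<Rightarrow> 'a set set \<Rightarrow> nat \<Rightarrow> real" where
  "graph_eigenvalue V E k = graph_eigenvalues V E ! (k - 1)"

definition complete_bipartite_vertices :: "nat \<Rightarrow> nat \<Rightarrow> (nat + nat) set" where
  "complete_bipartite_vertices a b = {..<a} <+> {..<b}"

definition complete_bipartite_edges :: "nat \<Rightarrow> nat \<Rightarrow> (nat + nat) set set" where
  "complete_bipartite_edges a b = {{Inl i, Inr j} |i j. i < a \<and> j < b}"

definition relabel :: "('a \<Rightarrow> 'b) \<Rightarrow> 'a set set \<Rightarrow> 'b set set" where
  "relabel f E = (\<lambda>e. f ` e) ` E"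

end

theory Submission
  imports Defs
begin

text \<open>
  Since \<open>A\<close> has second eigenvalue at most \<open>c\<close> and the all-ones vector is an eigenvector with eigenvalue
  \<open>n/2\<close>, the matrix \<open>B = 2 (c I + J/2 - A)\<close> is positive semidefinite. Its diagonal entries are
  \<open>D = 2 c + 1\<close>, its other entries are \<open>-1\<close> on edges and \<open>1\<close> on non-edges. Call a triple negative if the
  product of its three entries is \<open>-1\<close>. A complete tripartite system of negative triples with parts of
  size \<open>t \<ge> D\<close> would, after switching signs, give a vector with negative form. By pigeonhole such a system
  exists if every vertex lies in at least \<open>\<delta> n\<^sup>2\<close> negative triples and \<open>n\<close> is large. So some vertex \<open>a\<close> lies
  in few of them, which means that \<open>B u v = B a u B a v\<close> for almost all pairs: the graph is close to the
  complete bipartite graph between the vertices adjacent and non-adjacent to \<open>a\<close>. Regularity forces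
  this cut to be nearly balanced.
\<close>

section \<open>Positive semidefiniteness from the absence of negative eigenvalues\<close>

text \<open>Each product of two coordinates is at most \<open>x \<bullet> x\<close> in absolute
  value, so the sum of the absolute values of all entries serves as bound. Adding 1 keeps the
  constant positive when \<open>M\<close> is zero or empty.\<close>

lemma quadratic_form_bound:
  fixes M :: "real mat"
  assumes M: "M \<in> carrier_mat n n"
  obtains C where "C > 0" "\<And>x. x \<in> carrier_vec n \<Longrightarrow> \<bar>x \<bullet> (M *\<^sub>v x)\<bar> \<le> C * (x \<bullet> x)"
proof -
  define C where "C = 1 + (\<Sum>i = 0..<n. \<Sum>j = 0..<n. \<bar>M $$ (i, j)\<bar>)"
  have "C > 0"
    unfolding C_def by (intro add_pos_nonneg sum_nonneg) auto
  moreover have "\<bar>x \<bullet> (M *\<^sub>v x)\<bar> \<le> C * (x \<bullet> x)" if x: "x \<in> carrier_vec n" for x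
  proof -
    have sq: "(x $ i)\<^sup>2 \<le> x \<bullet> x" if "i < n" for i
    proof -
      have "(x $ i)\<^sup>2 \<le> (\<Sum>i = 0..<n. (x $ i)\<^sup>2)"
        using that by (intro member_le_sum) auto
      then show ?thesis
        using x by (simp add: scalar_prod_def power2_eq_square)
    qed
    have "x \<bullet> (M *\<^sub>v x) = (\<Sum>i = 0..<n. \<Sum>j = 0..<n. x $ i * (M $$ (i, j) * x $ j))"
      using x M by (auto simp: scalar_prod_def sum_distrib_left intro!: sum.cong)
    also have "\<bar>\<dots>\<bar> \<le> (\<Sum>i = 0..<n. \<Sum>j = 0..<n. \<bar>x $ i * (M $$ (i, j) * x $ j)\<bar>)"
      by (rule order_trans[OF sum_abs sum_mono]) (rule sum_abs)
    also have "\<dots> \<le> (\<Sum>i = 0..<n. \<Sum>j = 0..<n. \<bar>M $$ (i, j)\<bar> * (x \<bullet> x))"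
    proof (intro sum_mono)
      fix i j assume "i \<in> {0..<n}" "j \<in> {0..<n}"
      then have "(x $ i)\<^sup>2 \<le> x \<bullet> x" "(x $ j)\<^sup>2 \<le> x \<bullet> x"
        by (auto intro: sq)
      moreover have "2 * (\<bar>x $ i\<bar> * \<bar>x $ j\<bar>) \<le> (x $ i)\<^sup>2 + (x $ j)\<^sup>2"
        using sum_squares_bound[of "\<bar>x $ i\<bar>" "\<bar>x $ j\<bar>"] by simp
      ultimately have "\<bar>x $ i\<bar> * \<bar>x $ j\<bar> \<le> x \<bullet> x"
        by linarith
      then have "\<bar>M $$ (i, j)\<bar> * (\<bar>x $ i\<bar> * \<bar>x $ j\<bar>) \<le> \<bar>M $$ (i, j)\<bar> * (x \<bullet> x)"
        by (rule mult_left_mono) simp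
      then show "\<bar>x $ i * (M $$ (i, j) * x $ j)\<bar> \<le> \<bar>M $$ (i, j)\<bar> * (x \<bullet> x)"
        by (simp add: abs_mult mult_ac)
    qed
    also have "\<dots> = (C - 1) * (x \<bullet> x)"
      by (simp add: C_def sum_distrib_right)
    also have "\<dots> \<le> C * (x \<bullet> x)"
      using x by (intro mult_right_mono) (auto simp: scalar_prod_def intro: sum_nonneg)
    finally show ?thesis .
  qed
  ultimately show thesis
    by (rule that)
qed

lemma symmetric_scalar_prod_mult_mat_vec:
  fixes M :: "real mat"
  assumes "M \<in> carrier_mat n n" "M\<^sup>T = M" "x \<in> carrier_vec n" "y \<in> carrier_vec n"
  shows "x \<bullet> (M *\<^sub>v y) = y \<bullet> (M *\<^sub>v x)"
  using transpose_vec_mult_scalar[OF assms(1,4,3)] assms by (simp add: comm_scalar_prod[of _ n])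

text \<open>Expanding the form at \<open>C x - M\<inverse> x\<close>, where \<open>C\<close> bounds the form of \<open>M\<inverse>\<close>, bounds it from below.\<close>

lemma psd_invertible_imp_pos_def:
  fixes M :: "real mat"
  assumes M: "M \<in> carrier_mat n n" "M\<^sup>T = M" and det: "det M \<noteq> 0"
    and psd: "\<And>x. x \<in> carrier_vec n \<Longrightarrow> 0 \<le> x \<bullet> (M *\<^sub>v x)"
  obtains r where "r > 0" "\<And>x. x \<in> carrier_vec n \<Longrightarrow> r * (x \<bullet> x) \<le> x \<bullet> (M *\<^sub>v x)"
proof -
  from det_non_zero_imp_unit[OF M(1) det, of "()"]
  obtain M' where M': "M' \<in> carrier_mat n n" "M * M' = 1\<^sub>m n"
    unfolding Units_def by (auto simp: ring_mat_def)
  obtain C where C: "C > 0" "\<And>x. x \<in> carrier_vec n \<Longrightarrow> \<bar>x \<bullet> (M' *\<^sub>v x)\<bar> \<le> C * (x \<bullet> x)"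
    using quadratic_form_bound[OF M'(1)] by blast
  have "1 / C * (x \<bullet> x) \<le> x \<bullet> (M *\<^sub>v x)" if x: "x \<in> carrier_vec n" for x
  proof -
    define y where "y = M' *\<^sub>v x"
    have y: "y \<in> carrier_vec n"
      using x M' by (simp add: y_def)
    have My: "M *\<^sub>v y = x"
      using x M' M by (simp add: y_def flip: assoc_mult_mat_vec)
    have Mx: "M *\<^sub>v x \<in> carrier_vec n"
      using M x by simp
    have xy: "y \<bullet> (M *\<^sub>v x) = x \<bullet> x"
      using symmetric_scalar_prod_mult_mat_vec[OF M y x] My by simp
    have yx: "y \<bullet> x \<le> C * (x \<bullet> x)"
      using C(2)[OF x] comm_scalar_prod[OF x y] by (simp add: y_def)
    have "M *\<^sub>v (C \<cdot>\<^sub>v x - y) = C \<cdot>\<^sub>v (M *\<^sub>v x) - x"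
      using M x y My by (simp add: mult_minus_distrib_mat_vec[of _ n n] mult_mat_vec[of _ n n])
    then have "(C \<cdot>\<^sub>v x - y) \<bullet> (M *\<^sub>v (C \<cdot>\<^sub>v x - y))
        = C * (C * (x \<bullet> (M *\<^sub>v x)) - x \<bullet> x) - (C * (x \<bullet> x) - y \<bullet> x)"
      using x y Mx xy
      by (simp add: minus_scalar_prod_distrib[of _ n] scalar_prod_minus_distrib[of _ n] right_diff_distrib)
    \<comment> \<open>With \<open>q\<close> the form at \<open>x\<close>, semidefiniteness gives
      \<open>C * C * q - 2 * C * (x \<bullet> x) + y \<bullet> x \<ge> 0\<close>. The bound on
      \<open>y \<bullet> x\<close> absorbs one of the two copies of
      \<open>C * (x \<bullet> x)\<close>.\<close>
    with psd[of "C \<cdot>\<^sub>v x - y"] x y yx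
    have "C * (x \<bullet> x) \<le> C * (C * (x \<bullet> (M *\<^sub>v x)))"
      by (simp add: algebra_simps)
    with C(1) show ?thesis
      by (simp add: field_simps)
  qed
  with C(1) show thesis
    by (intro that[of "1 / C"]) auto
qed

text \<open>
  Let \<open>s\<close> be the infimum of all \<open>s \<ge> 0\<close> such that \<open>M + s I\<close> is positive semidefinite. If \<open>s > 0\<close>, then
  \<open>M + s I\<close> is invertible, so a smaller shift would suffice.
\<close>

lemma psd_if_no_negative_eigenvalue:
  fixes M :: "real mat"
  assumes M: "M \<in> carrier_mat n n" "M\<^sup>T = M"
    and det: "\<And>s. s > 0 \<Longrightarrow> det (M + s \<cdot>\<^sub>m 1\<^sub>m n) \<noteq> 0"
    and x: "x \<in> carrier_vec n"
  shows "0 \<le> x \<bullet> (M *\<^sub>v x)"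
proof -
  let ?psd = "\<lambda>s. \<forall>x \<in> carrier_vec n. 0 \<le> x \<bullet> (M *\<^sub>v x) + s * (x \<bullet> x)"
  define S where "S = {s. 0 \<le> s \<and> ?psd s}"
  obtain C where C: "C > 0" "\<And>x. x \<in> carrier_vec n \<Longrightarrow> \<bar>x \<bullet> (M *\<^sub>v x)\<bar> \<le> C * (x \<bullet> x)"
    using quadratic_form_bound[OF M(1)] by blast
  have "C \<in> S"
    using C(1) C(2) by (force simp: S_def abs_le_iff)
  then have ne: "S \<noteq> {}" by auto
  have bdd: "bdd_below S"
    by (rule bdd_belowI[of _ 0]) (simp add: S_def)
  define s where "s = Inf S"
  have s0: "s \<ge> 0"
    unfolding s_def by (rule cInf_greatest[OF ne]) (simp add: S_def)
  have nonneg: "0 \<le> x \<bullet> x" if "x \<in> carrier_vec n" for x :: "real vec"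
    using that by (auto simp: scalar_prod_def intro: sum_nonneg)
  \<comment> \<open>The infimum is attained: members of \<open>S\<close> come arbitrarily close to
    \<open>s\<close>. The summand 1 in the denominators avoids a division by zero at
    \<open>x = 0\<close>.\<close>
  have psd: "0 \<le> x \<bullet> (M *\<^sub>v x) + s * (x \<bullet> x)" if x: "x \<in> carrier_vec n" for x
  proof (rule field_le_epsilon)
    fix e :: real assume "e > 0"
    have pos: "x \<bullet> x + 1 > 0"
      using nonneg[OF x] by simp
    then have "Inf S < s + e / (x \<bullet> x + 1)"
      using \<open>e > 0\<close> by (simp add: s_def)
    then obtain t where t: "t \<in> S" "t < s + e / (x \<bullet> x + 1)"
      using cInf_lessD[OF ne] by blast
    have "0 \<le> x \<bullet> (M *\<^sub>v x) + t * (x \<bullet> x)"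
      using t(1) x by (simp add: S_def)
    also have "t * (x \<bullet> x) \<le> (s + e / (x \<bullet> x + 1)) * (x \<bullet> x)"
      using t(2) nonneg[OF x] by (intro mult_right_mono) auto
    also have "\<dots> = s * (x \<bullet> x) + e * ((x \<bullet> x) / (x \<bullet> x + 1))"
      by (simp add: distrib_right)
    also have "e * ((x \<bullet> x) / (x \<bullet> x + 1)) \<le> e"
      using pos \<open>e > 0\<close> by (simp add: field_simps)
    finally show "0 \<le> x \<bullet> (M *\<^sub>v x) + s * (x \<bullet> x) + e"
      by simp
  qed
  have "s = 0"
  proof (rule ccontr)
    assume "s \<noteq> 0"
    with s0 have "s > 0" by simp
    let ?N = "M + s \<cdot>\<^sub>m 1\<^sub>m n"
    have N: "?N \<in> carrier_mat n n" "?N\<^sup>T = ?N"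
    proof -
      have "(s \<cdot>\<^sub>m 1\<^sub>m n)\<^sup>T = (s \<cdot>\<^sub>m 1\<^sub>m n :: real mat)"
        by (rule eq_matI) auto
      then show "?N\<^sup>T = ?N"
        using M by (simp add: transpose_add[of _ n n])
    qed (use M in auto)
    have form: "x \<bullet> (?N *\<^sub>v x) = x \<bullet> (M *\<^sub>v x) + s * (x \<bullet> x)" if "x \<in> carrier_vec n" for x
    proof -
      have "(s \<cdot>\<^sub>m 1\<^sub>m n) *\<^sub>v x = s \<cdot>\<^sub>v x"
        using that by (intro eq_vecI) auto
      then have "?N *\<^sub>v x = M *\<^sub>v x + s \<cdot>\<^sub>v x"
        using that M by (simp add: add_mult_distrib_mat_vec[of _ n n])
      then show ?thesis
        using that M by (simp add: scalar_prod_add_distrib[of _ n])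
    qed
    obtain r where r: "r > 0" "\<And>x. x \<in> carrier_vec n \<Longrightarrow> r * (x \<bullet> x) \<le> x \<bullet> (?N *\<^sub>v x)"
      using psd_invertible_imp_pos_def[OF N det[OF \<open>s > 0\<close>]] psd form by (metis (no_types, lifting))
    \<comment> \<open>The form of \<open>?N\<close> has \<open>r\<close> to spare. Cutting off at 0
      keeps \<open>t\<close> admissible for \<open>S\<close>, and \<open>t < s\<close> still holds
      as \<open>s\<close> and \<open>r\<close> are positive.\<close>
    define t where "t = max 0 (s - r)"
    have "0 \<le> x \<bullet> (M *\<^sub>v x) + t * (x \<bullet> x)" if x: "x \<in> carrier_vec n" for x
    proof -
      have "(s - r) * (x \<bullet> x) \<le> t * (x \<bullet> x)"
        using nonneg[OF x] by (intro mult_right_mono) (auto simp: t_def)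
      with r(2)[OF x] form[OF x] show ?thesis
        by (simp add: algebra_simps)
    qed
    then have "t \<in> S"
      by (simp add: S_def t_def)
    then have "s \<le> t"
      unfolding s_def by (rule cInf_lower[OF _ bdd])
    with \<open>s > 0\<close> r(1) show False
      by (simp add: t_def)
  qed
  with psd[OF x] show ?thesis by simp
qed

section \<open>Characteristic polynomials of matrices with constant row sums, and the second largest
  root\<close>

text \<open>Conjugation by the matrix whose first column is the all-ones vector and that otherwise is the identity.\<close>

lemma char_poly_constant_row_sums:
  fixes A :: "real mat"
  assumes A: "A \<in> carrier_mat (Suc m) (Suc m)"
    and rows: "\<And>i. i < Suc m \<Longrightarrow> (\<Sum>j = 0..<Suc m. A $$ (i, j)) = d"
  shows "char_poly A = [:-d, 1:] * char_poly (mat m m (\<lambda>(i, j). A $$ (Suc i, Suc j) - A $$ (0, Suc j)))"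
proof -
  let ?n = "Suc m"
  define S :: "real mat" where "S = mat ?n ?n (\<lambda>(i, j). if j = 0 \<or> i = j then 1 else 0)"
  define T :: "real mat" where "T = mat ?n ?n (\<lambda>(i, j). if i = j then 1 else if j = 0 then -1 else 0)"
  define B1 :: "real mat" where "B1 = mat 1 1 (\<lambda>_. d)"
  define B2 :: "real mat" where "B2 = mat 1 m (\<lambda>(i, j). A $$ (0, Suc j))"
  define B4 :: "real mat" where "B4 = mat m m (\<lambda>(i, j). A $$ (Suc i, Suc j) - A $$ (0, Suc j))"
  \<comment> \<open>\<open>A\<close> maps the first column of \<open>S\<close> to \<open>d\<close>
    times itself, so \<open>T * A * S\<close> has first column \<open>(d, 0, ..., 0)\<close>.
    Multiplying by \<open>T\<close> subtracts row 0 from the other rows, which gives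
    \<open>B4\<close>.\<close>
  define B where "B = four_block_mat B1 B2 (0\<^sub>m m 1) B4"
  have blocks: "B1 \<in> carrier_mat 1 1" "B2 \<in> carrier_mat 1 m" "B4 \<in> carrier_mat m m"
    by (auto simp: B1_def B2_def B4_def)
  have S: "S \<in> carrier_mat ?n ?n" and T: "T \<in> carrier_mat ?n ?n"
    by (auto simp: S_def T_def)
  have B: "B \<in> carrier_mat ?n ?n"
    unfolding B_def using four_block_carrier_mat[OF blocks(1,3)] by simp
  have Bij: "B $$ (i, j) = (if j = 0 then if i = 0 then d else 0
      else if i = 0 then A $$ (0, j) else A $$ (i, j) - A $$ (0, j))" if "i < ?n" "j < ?n" for i j
    using that by (auto simp: B_def B1_def B2_def B4_def)
  have split_if: "(if b then (1::real) else 0) * x = (if b then x else 0)"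
    "x * (if b then (1::real) else 0) = (if b then x else 0)" for b x
    by auto
  have SX: "(S * X) $$ (i, j) = X $$ (0, j) + (if i = 0 then 0 else X $$ (i, j))"
    if "X \<in> carrier_mat ?n ?n" "i < ?n" "j < ?n" for X i j
  proof -
    have "(S * X) $$ (i, j) = (\<Sum>k = 0..<?n. (if k = 0 \<or> i = k then 1 else 0) * X $$ (k, j))"
      using that by (simp add: S_def scalar_prod_def del: sum.op_ivl_Suc)
    also have "\<dots> = (\<Sum>k = 0..<?n. (if k = 0 then X $$ (0, j) else 0)
        + (if k = i then if i = 0 then 0 else X $$ (i, j) else 0))"
      by (intro sum.cong) auto
    also have "\<dots> = X $$ (0, j) + (if i = 0 then 0 else X $$ (i, j))"
      using that by (simp add: sum.distrib sum.delta del: sum.op_ivl_Suc)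
    finally show ?thesis .
  qed
  have ST: "S * T = 1\<^sub>m ?n"
  proof (rule eq_matI)
    fix i j assume "i < dim_row (1\<^sub>m ?n :: real mat)" "j < dim_col (1\<^sub>m ?n :: real mat)"
    then show "(S * T) $$ (i, j) = 1\<^sub>m ?n $$ (i, j)"
      by (simp add: SX[OF T]) (auto simp: T_def)
  qed (use S T in auto)
  have TS: "T * S = 1\<^sub>m ?n"
    using mat_mult_left_right_inverse[OF S T ST] .
  have "A * S = S * B"
  proof (rule eq_matI)
    fix i j assume "i < dim_row (S * B)" "j < dim_col (S * B)"
    then have ij: "i < ?n" "j < ?n" using S B by auto
    have "(A * S) $$ (i, j) = (\<Sum>k = 0..<?n. A $$ (i, k) * (if j = 0 \<or> k = j then 1 else 0))"
      using ij A by (simp add: S_def scalar_prod_def del: sum.op_ivl_Suc)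
    also have "\<dots> = (if j = 0 then d else A $$ (i, j))"
      using ij rows[of i] by (simp add: split_if sum.delta del: sum.op_ivl_Suc cong: if_cong)
    finally have 1: "(A * S) $$ (i, j) = (if j = 0 then d else A $$ (i, j))" .
    have "(S * B) $$ (i, j) = (if j = 0 then d else A $$ (i, j))"
      using ij by (simp add: SX[OF B] Bij)
    then show "(A * S) $$ (i, j) = (S * B) $$ (i, j)"
      using 1 by simp
  qed (use A S B in auto)
  then have "S * B * T = A * (S * T)"
    using A S T by (metis assoc_mult_mat)
  then have "A = S * B * T"
    using A by (simp add: ST)
  from similar_mat_witI[OF ST TS this A B S T] have "char_poly A = char_poly B"
    by (intro char_poly_similar) (auto simp: similar_mat_def)
  also have "\<dots> = char_poly B1 * char_poly B4"
    unfolding B_def by (rule char_poly_four_block_zeros_col[OF blocks])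
  also have "char_poly B1 = [:-d, 1:]"
    by (simp add: char_poly_defs B1_def det_single)
  finally show ?thesis
    by (simp add: B4_def)
qed

text \<open>If the second entry of the decreasing list were below \<open>min a b\<close>, only the
  head could reach that value, but the multiset has two such elements. Inclusion respects
  multiplicity, so \<open>a = b\<close> is covered as a double element.\<close>

lemma second_largest_ge:
  fixes M :: "real multiset"
  assumes "{#a, b#} \<subseteq># M"
  shows "min a b \<le> rev (sorted_list_of_multiset M) ! 1"
proof (rule ccontr)
  let ?r = "rev (sorted_list_of_multiset M)"
  assume *: "\<not> ?thesis"
  have mset: "mset ?r = M" by simp
  have "size {#a, b#} \<le> size M"
    using assms by (rule size_mset_mono)
  then have len: "length ?r \<ge> 2"
    by (metis mset size_mset size_add_mset size_empty numeral_2_eq_2)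
  have sorted: "sorted_wrt (\<ge>) ?r"
    by (simp add: sorted_wrt_rev)
  then obtain x y zs where r: "?r = x # y # zs"
    using len by (metis One_nat_def Suc_1 Suc_le_length_iff)
  have small: "z < min a b" if "z \<in> set (y # zs)" for z
    using sorted that * r by force
  have M: "M = add_mset x (mset (y # zs))"
    using mset r by (metis mset.simps(2))
  have "filter_mset (\<lambda>z. z \<ge> min a b) {#a, b#} \<subseteq># filter_mset (\<lambda>z. z \<ge> min a b) M"
    by (rule multiset_filter_mono[OF assms])
  moreover have "filter_mset (\<lambda>z. z \<ge> min a b) (mset (y # zs)) = {#}"
    using small unfolding mset_filter[symmetric] by (force simp: filter_empty_conv)
  ultimately have "{#a, b#} \<subseteq># filter_mset (\<lambda>z. z \<ge> min a b) {#x#}"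
    by (simp add: M split: if_splits)
  then have "size {#a, b#} \<le> size {#x#}"
    by (metis multiset_filter_subset size_mset_mono order_trans)
  then show False by simp
qed

section \<open>The shifted Seidel matrix of a regular graph with bounded second eigenvalue\<close>

text \<open>For a simple graph this is the Seidel matrix \<open>J - I - 2 A\<close> plus
  \<open>D I\<close>. With \<open>D = 2 c + 1\<close> it equals
  \<open>2 (c I + J/2 - A)\<close>.\<close>

definition shifted_seidel :: "real \<Rightarrow> 'a set set \<Rightarrow> 'a \<Rightarrow> 'a \<Rightarrow> real" where
  "shifted_seidel D E u v = (if u = v then D else if {u, v} \<in> E then -1 else 1)"

text \<open>Degrees count edges, whereas row sums of the adjacency matrix count neighbours; sending
  a neighbour to its edge translates between them.\<close>

lemma card_neighbours:
  assumes "simple_graph V E" "u \<in> V"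
  shows "card {v \<in> V. {u, v} \<in> E} = degree_in E u"
proof -
  interpret simple_graph V E by fact
  have "bij_betw (\<lambda>v. {u, v}) {v \<in> V. {u, v} \<in> E} {e \<in> E. u \<in> e}"
  proof (rule bij_betw_imageI)
    show "inj_on (\<lambda>v. {u, v}) {v \<in> V. {u, v} \<in> E}"
      by (auto simp: inj_on_def doubleton_eq_iff)
    have "e \<in> (\<lambda>v. {u, v}) ` {v \<in> V. {u, v} \<in> E}" if "e \<in> E" "u \<in> e" for e
    proof -
      have "e \<subseteq> V" "card e = 2"
        using that edges_subset by auto
      then obtain v where "e = {u, v}"
        using \<open>u \<in> e\<close> by (metis card_2_iff insert_commute insert_iff singletonD)
      with that \<open>e \<subseteq> V\<close> show ?thesis by auto
    qed
    then show "(\<lambda>v. {u, v}) ` {v \<in> V. {u, v} \<in> E} = {e \<in> E. u \<in> e}"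
      by auto
  qed
  then show ?thesis
    by (simp add: bij_betw_same_card degree_in_def)
qed

lemma no_loops:
  assumes "simple_graph V E"
  shows "{v} \<notin> E" "{v, v} \<notin> E"
  using simple_graph.edges_subset[OF assms] by auto

lemma sum_neighbours:
  assumes "simple_graph V E" "u \<in> V"
  shows "(\<Sum>v\<in>V. if {u, v} \<in> E then 1 else 0) = real (degree_in E u)"
  using simple_graph.finite_vertices[OF assms(1)]
  by (simp add: sum.If_cases Int_def flip: card_neighbours[OF assms])

text \<open>
  The adjacency matrix \<open>A\<close> and \<open>A - J/2\<close> have the same spectrum, except that the eigenvalue \<open>n/2\<close> of the
  all-ones vector is replaced by 0. Hence \<open>c I + J/2 - A\<close> is positive semidefinite.
\<close>

lemma shifted_seidel_psd:
  fixes V :: "'a set"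
  assumes G: "simple_graph V E" and reg: "regular_graph V E (card V div 2)" and even: "even (card V)"
    and eig: "graph_eigenvalue V E 2 \<le> c" and c: "0 \<le> c" "c < real (card V) / 2"
  shows "0 \<le> (\<Sum>u\<in>V. \<Sum>v\<in>V. f u * f v * shifted_seidel (2 * c + 1) E u v)"
proof -
  obtain vs where vs: "distinct vs" "set vs = V"
    using finite_distinct_list[OF simple_graph.finite_vertices[OF G]] by blast
  define n where "n = length vs"
  have n: "card V = n"
    using vs by (auto simp: n_def distinct_card)
  obtain m where m: "n = Suc m"
    using c n by (cases n) auto
  define A where "A = adjacency_matrix vs E"
  have A: "A \<in> carrier_mat n n"
    by (simp add: A_def adjacency_matrix_def n_def)
  have Aij: "A $$ (i, j) = (if {vs ! i, vs ! j} \<in> E then 1 else 0)" if "i < n" "j < n" for i j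
    using that by (simp add: A_def adjacency_matrix_def n_def)
  have reindex: "(\<Sum>i = 0..<n. g (vs ! i)) = (\<Sum>v\<in>V. g v)" for g :: "'a \<Rightarrow> real"
    using vs by (intro sum.reindex_bij_betw bij_betw_nth) (auto simp: n_def)
  have inV: "vs ! i \<in> V" if "i < n" for i
    using that vs by (auto simp: n_def)
  have rows: "(\<Sum>j = 0..<n. A $$ (i, j)) = real n / 2" if "i < n" for i
  proof -
    have "(\<Sum>j = 0..<n. A $$ (i, j)) = (\<Sum>j = 0..<n. if {vs ! i, vs ! j} \<in> E then 1 else 0)"
      using that by (intro sum.cong) (auto simp: Aij)
    also have "\<dots> = (\<Sum>v\<in>V. if {vs ! i, v} \<in> E then 1 else 0)"
      by (rule reindex)
    also have "\<dots> = real (card V div 2)"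
      using sum_neighbours[OF G inV[OF that]] reg inV[OF that] by (simp add: regular_graph_def)
    finally show ?thesis
      using even by (simp add: n real_of_nat_div)
  qed
  \<comment> \<open>Subtracting the same constant from all entries leaves differences of rows
    unchanged, so \<open>A\<close> and \<open>A0\<close> share the factor \<open>p\<close> below,
    while the row sums drop to 0.\<close>
  define A0 where "A0 = mat n n (\<lambda>(i, j). A $$ (i, j) - 1 / 2)"
  have A0: "A0 \<in> carrier_mat n n"
    by (simp add: A0_def)
  have rows0: "(\<Sum>j = 0..<n. A0 $$ (i, j)) = 0" if "i < n" for i
    using rows[OF that] that by (simp add: A0_def sum_subtractf)
  define p where "p = char_poly (mat m m (\<lambda>(i, j). A $$ (Suc i, Suc j) - A $$ (0, Suc j)))"
  have pA: "char_poly A = [:- (real n / 2), 1:] * p"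
    unfolding p_def by (rule char_poly_constant_row_sums) (use A rows in \<open>auto simp: m simp del: sum.op_ivl_Suc\<close>)
  have "mat m m (\<lambda>(i, j). A0 $$ (Suc i, Suc j) - A0 $$ (0, Suc j))
      = mat m m (\<lambda>(i, j). A $$ (Suc i, Suc j) - A $$ (0, Suc j))"
    by (rule eq_matI) (auto simp: A0_def m)
  then have pA0: "char_poly A0 = [:0, 1:] * p"
    using char_poly_constant_row_sums[of A0 m 0] A0 rows0 by (simp add: p_def m del: sum.op_ivl_Suc)
  have "p \<noteq> 0"
    using degree_monic_char_poly[OF A] pA by auto
  \<comment> \<open>Such a root would occur besides the root \<open>n/2\<close> of the linear
    factor. Both exceed \<open>c\<close>, so the second largest eigenvalue would too.\<close>
  have root: "poly p (c + s) \<noteq> 0" if "s > 0" for s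
  proof
    assume "poly p (c + s) = 0"
    then have "c + s \<in># proots p"
      using \<open>p \<noteq> 0\<close> by simp
    then have "{#real n / 2, c + s#} \<subseteq># proots (char_poly A)"
      unfolding pA using \<open>p \<noteq> 0\<close> by (subst proots_mult) auto
    then have "min (real n / 2) (c + s) \<le> graph_eigenvalue V E 2"
      unfolding graph_eigenvalue_def graph_eigenvalues_def graph_char_poly_eq[OF vs] A_def
      using second_largest_ge by force
    with eig c that n show False
      by (simp add: min_def split: if_splits)
  qed
  define M where "M = mat n n (\<lambda>(i, j). (if i = j then c else 0) + 1 / 2 - A $$ (i, j))"
  have M: "M \<in> carrier_mat n n"
    by (simp add: M_def)
  have MT: "M\<^sup>T = M"
    by (rule eq_matI) (auto simp: M_def Aij insert_commute)
  have det: "det (M + s \<cdot>\<^sub>m 1\<^sub>m n) \<noteq> 0" if "s > 0" for s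
  proof -
    \<comment> \<open>As \<open>M = c I - A0\<close>, the determinant is the characteristic
      polynomial of \<open>A0\<close> at \<open>c + s\<close>. Its extra factor \<open>c + s\<close>
      is nonzero because \<open>c \<ge> 0\<close>.\<close>
    have "M + s \<cdot>\<^sub>m 1\<^sub>m n = - char_matrix A0 (c + s)"
      by (rule eq_matI) (auto simp: M_def A0_def char_matrix_def)
    then have "det (M + s \<cdot>\<^sub>m 1\<^sub>m n) = (c + s) * poly p (c + s)"
      using char_poly_matrix[OF A0, of "c + s"] by (simp add: pA0)
    with root[OF that] c that show ?thesis by simp
  qed
  define x where "x = vec n (\<lambda>i. f (vs ! i))"
  have "0 \<le> x \<bullet> (M *\<^sub>v x)"
    by (rule psd_if_no_negative_eigenvalue[OF M MT det]) (simp_all add: x_def)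
  also have "\<dots> = (\<Sum>i = 0..<n. \<Sum>j = 0..<n. f (vs ! i) * f (vs ! j) * shifted_seidel (2 * c + 1) E (vs ! i) (vs ! j) / 2)"
    unfolding scalar_prod_def
  proof (simp add: x_def M_def scalar_prod_def sum_distrib_left, intro sum.cong refl)
    fix i j assume "i \<in> {0..<n}" "j \<in> {0..<n}"
    moreover from this have "vs ! i = vs ! j \<longleftrightarrow> i = j"
      using vs(1) by (simp add: n_def nth_eq_iff_index_eq)
    ultimately show "f (vs ! i) * (((if i = j then c else 0) + 1 / 2 - A $$ (i, j)) * f (vs ! j))
        = f (vs ! i) * f (vs ! j) * shifted_seidel (2 * c + 1) E (vs ! i) (vs ! j) / 2"
      using no_loops[OF G] by (auto simp: Aij shifted_seidel_def field_simps)
  qed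
  also have "\<dots> = (\<Sum>u\<in>V. \<Sum>v\<in>V. f u * f v * shifted_seidel (2 * c + 1) E u v / 2)"
    by (subst reindex[symmetric], subst reindex[symmetric]) simp
  finally show ?thesis
    by (simp flip: sum_divide_distrib)
qed

section \<open>Density and pigeonhole: complete tripartite subsystems\<close>

text \<open>Averaging: elements of \<open>Z\<close> with small fibres account for at most half of
  the total, and every other one contributes at most \<open>card X\<close>.\<close>

lemma many_large_fibres:
  fixes \<eta> :: real
  assumes fin: "finite X" "finite Z" and ne: "X \<noteq> {}" and "\<eta> > 0"
    and dense: "\<eta> * card X * card Z \<le> (\<Sum>z\<in>Z. real (card {x \<in> X. F x z}))"
  shows "\<eta> / 2 * card Z \<le> card {z \<in> Z. \<eta> / 2 * card X \<le> card {x \<in> X. F x z}}"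
proof -
  define Z1 where "Z1 = {z \<in> Z. \<eta> / 2 * card X \<le> card {x \<in> X. F x z}}"
  have Z1: "Z1 \<subseteq> Z" "finite Z1"
    using fin by (auto simp: Z1_def)
  have pos: "real (card X) > 0"
    using fin ne by (simp add: card_gt_0_iff)
  have "\<eta> * card X * card Z \<le> (\<Sum>z\<in>Z. (if z \<in> Z1 then real (card X) else 0) + \<eta> / 2 * card X)"
  proof (rule order_trans[OF dense], rule sum_mono)
    fix z assume "z \<in> Z"
    have "card {x \<in> X. F x z} \<le> card X"
      using fin by (intro card_mono) auto
    then show "real (card {x \<in> X. F x z}) \<le> (if z \<in> Z1 then real (card X) else 0) + \<eta> / 2 * card X"
      using \<open>z \<in> Z\<close> \<open>\<eta> > 0\<close> by (auto simp: Z1_def intro: add_increasing2)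
  qed
  also have "\<dots> = card Z1 * real (card X) + card Z * (\<eta> / 2 * card X)"
    using Z1 fin by (simp add: sum.distrib sum.If_cases Int_absorb1 Int_commute)
  finally have "card X * (\<eta> / 2 * card Z) \<le> card X * real (card Z1)"
    by (simp add: algebra_simps)
  then have "\<eta> / 2 * card Z \<le> card Z1"
    using pos by (simp only: mult_le_cancel_left_pos)
  then show ?thesis by (simp only: Z1_def)
qed

text \<open>The large fibres are among the \<open>2 ^ card X\<close> subsets of \<open>X\<close>, so
  by pigeonhole one of them is shared by many elements of \<open>Z\<close>. This is the step of the
  Kovari-Sos-Turan argument that is iterated below.\<close>

lemma popular_common_neighbourhood:
  fixes \<eta> :: real
  assumes fin: "finite X" "finite Z" and ne: "X \<noteq> {}" "Z \<noteq> {}" and "\<eta> > 0"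
    and dense: "\<eta> * card X * card Z \<le> (\<Sum>z\<in>Z. real (card {x \<in> X. F x z}))"
  obtains X' where "X' \<subseteq> X" "\<eta> / 2 * card X \<le> card X'"
    "\<eta> / 2 * card Z / 2 ^ card X \<le> card {z \<in> Z. \<forall>x\<in>X'. F x z}"
proof -
  define Z1 where "Z1 = {z \<in> Z. \<eta> / 2 * card X \<le> card {x \<in> X. F x z}}"
  have big: "\<eta> / 2 * card Z \<le> card Z1"
    unfolding Z1_def by (rule many_large_fibres) (use assms in auto)
  define N where "N = (\<lambda>z. {x \<in> X. F x z})"
  have "Z1 \<noteq> {}"
    using big \<open>\<eta> > 0\<close> fin ne by (auto simp: mult_le_0_iff)
  have finZ1: "finite Z1"
    using fin by (simp add: Z1_def)
  have "\<exists>S \<in> N ` Z1. \<eta> / 2 * card Z / 2 ^ card X \<le> card {z \<in> Z1. N z = S}"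
  proof (rule ccontr)
    assume "\<not> ?thesis"
    then have less: "real (card {z \<in> Z1. N z = S}) < \<eta> / 2 * card Z / 2 ^ card X" if "S \<in> N ` Z1" for S
      using that by force
    have "card (N ` Z1) \<le> card (Pow X)"
      using fin by (intro card_mono) (auto simp: N_def)
    then have le: "real (card (N ` Z1)) \<le> 2 ^ card X"
      using fin by (metis card_Pow of_nat_le_iff of_nat_numeral of_nat_power)
    have "real (card Z1) = (\<Sum>S\<in>N ` Z1. real (card {z \<in> Z1. N z = S}))"
      using sum.image_gen[OF finZ1, of "\<lambda>_. 1 :: real" N] by simp
    also have "\<dots> < (\<Sum>S\<in>N ` Z1. \<eta> / 2 * card Z / 2 ^ card X)"
      using finZ1 \<open>Z1 \<noteq> {}\<close> less by (intro sum_strict_mono) auto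
    also have "\<dots> = card (N ` Z1) * (\<eta> / 2 * card Z / 2 ^ card X)"
      by simp
    also have "\<dots> \<le> 2 ^ card X * (\<eta> / 2 * card Z / 2 ^ card X)"
      using le \<open>\<eta> > 0\<close> by (intro mult_right_mono) auto
    also have "\<dots> = \<eta> / 2 * card Z"
      by simp
    finally show False using big by simp
  qed
  then obtain z0 where z0: "z0 \<in> Z1" "\<eta> / 2 * card Z / 2 ^ card X \<le> card {z \<in> Z1. N z = N z0}"
    by auto
  have "card {z \<in> Z1. N z = N z0} \<le> card {z \<in> Z. \<forall>x\<in>N z0. F x z}"
    using fin by (intro card_mono) (auto simp: Z1_def N_def)
  with z0 show thesis
    by (intro that[of "N z0"]) (auto simp: N_def Z1_def)
qed

text \<open>This is the Erdos theorem on complete tripartite subsystems, for a hypothesis on every vertex of one side.\<close>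

lemma complete_tripartite_subsystem:
  fixes \<eta> :: real and t :: nat
  assumes "\<eta> > 0"
  obtains N where "\<And>(V :: 'a set) T. finite V \<Longrightarrow> N \<le> card V \<Longrightarrow>
    (\<And>a. a \<in> V \<Longrightarrow> \<eta> * real (card V) ^ 2 \<le> card {(y, z) \<in> V \<times> V. T a y z}) \<Longrightarrow>
    \<exists>X Y Z. X \<subseteq> V \<and> Y \<subseteq> V \<and> Z \<subseteq> V \<and> t \<le> card X \<and> t \<le> card Y \<and> t \<le> card Z \<and>
      (\<forall>x\<in>X. \<forall>y\<in>Y. \<forall>z\<in>Z. T x y z)"
proof -
  \<comment> \<open>\<open>m\<close> and \<open>m1\<close> are the sizes of the samples for the
    first and second side, large enough that the surviving fraction contains \<open>t\<close>
    elements. \<open>\<eta>1\<close> is the density left after pigeonholing over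
    \<open>2 ^ m\<close> subsets. \<open>N\<close> leaves room for both samples and for
    \<open>t\<close> elements on the third side.\<close>
  define m where "m = Suc (nat \<lceil>2 * t / \<eta>\<rceil>)"
  define \<eta>1 where "\<eta>1 = \<eta> / 2 / 2 ^ m"
  have "\<eta>1 > 0" using assms by (simp add: \<eta>1_def)
  define m1 where "m1 = Suc (nat \<lceil>4 * t / \<eta>1\<rceil>)"
  define N where "N = Suc (m + nat \<lceil>2 * m1 / \<eta>1\<rceil> + nat \<lceil>4 * t * 2 ^ m1 / \<eta>1\<rceil>)"
  have tm: "real t \<le> \<eta> / 2 * m"
  proof -
    have "2 * t / \<eta> \<le> m" unfolding m_def by linarith
    then show ?thesis using assms by (simp add: field_simps)
  qed
  have tm1: "real t \<le> \<eta>1 / 2 / 2 * m1"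
  proof -
    have "4 * t / \<eta>1 \<le> m1" unfolding m1_def by linarith
    then show ?thesis using \<open>\<eta>1 > 0\<close> by (simp add: field_simps)
  qed
  show thesis
  proof (rule that)
    fix V :: "'a set" and T
    assume V: "finite V" "N \<le> card V"
      and T: "\<And>a. a \<in> V \<Longrightarrow> \<eta> * real (card V) ^ 2 \<le> card {(y, z) \<in> V \<times> V. T a y z}"
    let ?n = "card V"
    have n0: "V \<noteq> {}" using V by (auto simp: N_def)
    have "m \<le> ?n" using V by (simp add: N_def)
    then obtain X0 where X0: "X0 \<subseteq> V" "card X0 = m" "finite X0"
      by (meson obtain_subset_with_card_n)
    have X0ne: "X0 \<noteq> {}" using X0 by (auto simp: m_def)
    \<comment> \<open>As the hypothesis concerns every vertex, \<open>X0\<close> can be an arbitrary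
      set of \<open>m\<close> vertices. Pairs play the role of the second side.\<close>
    have dense: "\<eta> * card X0 * card (V \<times> V) \<le> (\<Sum>p\<in>V \<times> V. real (card {x \<in> X0. T x (fst p) (snd p)}))"
    proof -
      have "\<eta> * card X0 * card (V \<times> V) = (\<Sum>x\<in>X0. \<eta> * real ?n ^ 2)"
        by (simp add: card_cartesian_product power2_eq_square)
      also have "\<dots> \<le> (\<Sum>x\<in>X0. real (card {p \<in> V \<times> V. T x (fst p) (snd p)}))"
      proof (rule sum_mono)
        fix x assume "x \<in> X0"
        moreover have "{(y, z) \<in> V \<times> V. T x y z} = {p \<in> V \<times> V. T x (fst p) (snd p)}" by auto
        ultimately show "\<eta> * real ?n ^ 2 \<le> real (card {p \<in> V \<times> V. T x (fst p) (snd p)})"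
          using T[of x] X0 by auto
      qed
      also have "\<dots> = real (\<Sum>x\<in>X0. card {p \<in> V \<times> V. T x (fst p) (snd p)})"
        by simp
      also have "(\<Sum>x\<in>X0. card {p \<in> V \<times> V. T x (fst p) (snd p)})
          = (\<Sum>p\<in>V \<times> V. card {x \<in> X0. T x (fst p) (snd p)})"
        using V X0 by (intro sum_multicount_gen) auto
      finally show ?thesis by simp
    qed
    obtain X where X: "X \<subseteq> X0" "\<eta> / 2 * card X0 \<le> card X"
      and W: "\<eta> / 2 * card (V \<times> V) / 2 ^ card X0 \<le> card {p \<in> V \<times> V. \<forall>x\<in>X. T x (fst p) (snd p)}"
      using popular_common_neighbourhood[OF _ _ X0ne _ assms dense] X0 V n0 by blast
    have tX: "t \<le> card X"
      using X(2) tm X0(2) by (metis of_nat_le_iff order_trans)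
    let ?R = "\<lambda>z y. \<forall>x\<in>X. T x y z"
    have dense1: "\<eta>1 * card V * card V \<le> (\<Sum>y\<in>V. real (card {z \<in> V. ?R z y}))"
    proof -
      have "{p \<in> V \<times> V. \<forall>x\<in>X. T x (fst p) (snd p)} = (SIGMA y:V. {z \<in> V. ?R z y})"
        by auto
      then have "card {p \<in> V \<times> V. \<forall>x\<in>X. T x (fst p) (snd p)} = (\<Sum>y\<in>V. card {z \<in> V. ?R z y})"
        using V by simp
      with W show ?thesis
        by (simp add: \<eta>1_def X0 card_cartesian_product)
    qed
    \<comment> \<open>The pairs that work for all of \<open>X\<close> form a dense bipartite graph.
      Restricting to vertices of large degree lets the second sample \<open>Y1\<close> be arbitrary
      as well.\<close>
    define Y0 where "Y0 = {y \<in> V. \<eta>1 / 2 * ?n \<le> card {z \<in> V. ?R z y}}"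
    have "\<eta>1 / 2 * ?n \<le> card Y0"
      unfolding Y0_def by (rule many_large_fibres[OF V(1) V(1) n0 \<open>\<eta>1 > 0\<close> dense1])
    moreover have "m1 \<le> \<eta>1 / 2 * ?n"
    proof -
      have "2 * m1 / \<eta>1 \<le> N" unfolding N_def by linarith
      then have "2 * m1 / \<eta>1 \<le> ?n" using V(2) by linarith
      then show ?thesis using \<open>\<eta>1 > 0\<close> by (simp add: field_simps)
    qed
    ultimately have "m1 \<le> card Y0" by linarith
    then obtain Y1 where Y1: "Y1 \<subseteq> Y0" "card Y1 = m1" "finite Y1"
      by (meson obtain_subset_with_card_n)
    have Y1ne: "Y1 \<noteq> {}" using Y1 by (auto simp: m1_def)
    have dense2: "\<eta>1 / 2 * card Y1 * card V \<le> (\<Sum>z\<in>V. real (card {y \<in> Y1. ?R z y}))"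
    proof -
      have "\<eta>1 / 2 * card Y1 * card V = (\<Sum>y\<in>Y1. \<eta>1 / 2 * ?n)"
        by simp
      also have "\<dots> \<le> (\<Sum>y\<in>Y1. real (card {z \<in> V. ?R z y}))"
        using Y1 by (intro sum_mono) (auto simp: Y0_def)
      also have "\<dots> = real (\<Sum>y\<in>Y1. card {z \<in> V. ?R z y})"
        by simp
      also have "(\<Sum>y\<in>Y1. card {z \<in> V. ?R z y}) = (\<Sum>z\<in>V. card {y \<in> Y1. ?R z y})"
        using V Y1 by (intro sum_multicount_gen) auto
      finally show ?thesis by simp
    qed
    obtain Y where Y: "Y \<subseteq> Y1" "\<eta>1 / 2 / 2 * card Y1 \<le> card Y"
      and Z: "\<eta>1 / 2 / 2 * card V / 2 ^ card Y1 \<le> card {z \<in> V. \<forall>y\<in>Y. ?R z y}"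
      using popular_common_neighbourhood[OF Y1(3) V(1) Y1ne n0 half_gt_zero[OF \<open>\<eta>1 > 0\<close>] dense2] by blast
    have tY: "t \<le> card Y"
      using Y(2) tm1 Y1(2) by (metis of_nat_le_iff order_trans)
    have "t \<le> \<eta>1 / 2 / 2 * ?n / 2 ^ m1"
    proof -
      have "4 * t * 2 ^ m1 / \<eta>1 \<le> N" unfolding N_def by linarith
      then have "4 * t * 2 ^ m1 / \<eta>1 \<le> ?n" using V(2) by linarith
      then show ?thesis using \<open>\<eta>1 > 0\<close> by (simp add: field_simps)
    qed
    with Z Y1(2) have "t \<le> card {z \<in> V. \<forall>y\<in>Y. ?R z y}" by simp
    with tX tY show "\<exists>X Y Z. X \<subseteq> V \<and> Y \<subseteq> V \<and> Z \<subseteq> V \<and> t \<le> card X \<and> t \<le> card Y \<and> t \<le> card Z \<and>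
      (\<forall>x\<in>X. \<forall>y\<in>Y. \<forall>z\<in>Z. T x y z)"
      using X(1) X0(1) Y(1) Y1(1)
      by (intro exI[of _ X] exI[of _ Y] exI[of _ "{z \<in> V. \<forall>y\<in>Y. ?R z y}"]) (auto simp: Y0_def)
  qed
qed

section \<open>Semidefiniteness excludes large systems of negative triples\<close>

text \<open>
  A negative triangle is switching equivalent to one whose three entries are all \<open>-1\<close>, and so is a
  complete tripartite system of them. After switching, the form at its indicator vector is negative.
\<close>

lemma no_complete_tripartite_negative_system:
  fixes B :: "'a \<Rightarrow> 'a \<Rightarrow> real"
  assumes V: "finite V" and sym: "\<And>u v. B u v = B v u" and diag: "\<And>v. B v v = D"
    and off: "\<And>u v. u \<noteq> v \<Longrightarrow> B u v = 1 \<or> B u v = -1"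
    and psd: "\<And>f. 0 \<le> (\<Sum>u\<in>V. \<Sum>v\<in>V. f u * f v * B u v)"
    and sub: "X \<subseteq> V" "Y \<subseteq> V" "Z \<subseteq> V"
    and card: "t \<le> card X" "t \<le> card Y" "t \<le> card Z" and t: "t > 0" "D \<le> real t"
    and neg: "\<And>x y z. x \<in> X \<Longrightarrow> y \<in> Y \<Longrightarrow> z \<in> Z \<Longrightarrow> distinct [x, y, z] \<and> B x y * B y z * B x z = -1"
  shows False
proof -
  obtain X' where X': "X' \<subseteq> X" "card X' = t" "finite X'" using card by (meson obtain_subset_with_card_n)
  obtain Y' where Y': "Y' \<subseteq> Y" "card Y' = t" "finite Y'" using card by (meson obtain_subset_with_card_n)
  obtain Z' where Z': "Z' \<subseteq> Z" "card Z' = t" "finite Z'" using card by (meson obtain_subset_with_card_n)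
  obtain x0 y0 z0 where pts: "x0 \<in> X'" "y0 \<in> Y'" "z0 \<in> Z'"
    using X' Y' Z' t by (metis card.empty ex_in_conv less_irrefl)
  have neg': "x \<noteq> y" "y \<noteq> z" "x \<noteq> z" "B x y * B y z * B x z = -1" if "x \<in> X'" "y \<in> Y'" "z \<in> Z'" for x y z
    using neg[of x y z] that X' Y' Z' by auto
  have disj: "X' \<inter> Y' = {}" "X' \<inter> Z' = {}" "Y' \<inter> Z' = {}"
    using neg' pts by blast+
  define r where "r = (\<lambda>x. B x y0 * B x0 y0)"
  \<comment> \<open>The signs are forced: \<open>x0\<close> gets sign 1, the entries at
    \<open>x0\<close> then fix the signs on \<open>Y'\<close> and \<open>Z'\<close>, and the entries
    at \<open>y0\<close> fix those on \<open>X'\<close>, each switched entry being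
    \<open>-1\<close>.\<close>
  define f where "f = (\<lambda>v. if v \<in> X' then r v else if v \<in> Y' \<union> Z' then - B x0 v else 0)"
  have sq: "B u v = 1 \<or> B u v = -1" if "(u \<in> X' \<and> v \<in> Y') \<or> (u \<in> X' \<and> v \<in> Z') \<or> (u \<in> Y' \<and> v \<in> Z')" for u v
    using that disj by (intro off) blast
  have fX: "f x = B x y0 * B x0 y0" if "x \<in> X'" for x
    using that by (simp add: f_def r_def)
  have fYZ: "f y = - B x0 y" if "y \<in> Y' \<union> Z'" for y
    using that disj by (auto simp: f_def)
  have xz: "f x * f z * B x z = -1" if "x \<in> X'" "z \<in> Z'" for x z
    using neg'(4)[of x y0 z] neg'(4)[of x0 y0 z] sq[of x y0] sq[of x0 y0] sq[of x z] sq[of x0 z] sq[of y0 z]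
      that pts by (simp add: fX fYZ) (elim disjE; simp)
  have yz: "f y * f z * B y z = -1" if "y \<in> Y'" "z \<in> Z'" for y z
    using neg'(4)[of x0 y z] sq[of x0 y] sq[of x0 z] sq[of y z]
      that pts by (simp add: fYZ) (elim disjE; simp)
  have f1: "f u = 1 \<or> f u = -1" if "u \<in> X' \<union> Y' \<union> Z'" for u
    using that sq[of u y0] sq[of x0 y0] sq[of x0 u] pts by (auto simp: fX fYZ)
  \<comment> \<open>Switching preserves the product over a triple, so two switched entries
    \<open>-1\<close> of a negative triple force the third.\<close>
  have xy: "f x * f y * B x y = -1" if "x \<in> X'" "y \<in> Y'" for x y
    using neg'(4)[OF that pts(3)] xz[OF that(1) pts(3)] yz[OF that(2) pts(3)]
      f1[of z0] sq[of x z0] sq[of y z0] that pts by (auto simp: minus_equation_iff)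
  have yx: "f y * f x * B y x = -1" if "x \<in> X'" "y \<in> Y'" for x y
    using xy[OF that] by (simp add: sym[of y x] mult.commute)
  have zx: "f z * f x * B z x = -1" if "x \<in> X'" "z \<in> Z'" for x z
    using xz[OF that] by (simp add: sym[of z x] mult.commute)
  have zy: "f z * f y * B z y = -1" if "y \<in> Y'" "z \<in> Z'" for y z
    using yz[OF that] by (simp add: sym[of z y] mult.commute)
  let ?U = "X' \<union> Y' \<union> Z'"
  have U: "?U \<subseteq> V" "finite ?U" using X' Y' Z' sub by auto
  have same: "(\<Sum>v\<in>S. f u * f v * B u v) \<le> D + (real t - 1)"
    if S: "S \<subseteq> ?U" "card S = t" "finite S" "u \<in> S" for S u
  proof -
    have "(\<Sum>v\<in>S. f u * f v * B u v) = f u * f u * B u u + (\<Sum>v\<in>S - {u}. f u * f v * B u v)"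
      using S by (intro sum.remove) auto
    also have "f u * f u * B u u = D"
      using f1[OF subsetD[OF S(1,4)]] diag[of u] by auto
    also have "(\<Sum>v\<in>S - {u}. f u * f v * B u v) \<le> (\<Sum>v\<in>S - {u}. 1)"
    proof (rule sum_mono)
      fix v assume "v \<in> S - {u}"
      then have "f u = 1 \<or> f u = -1" "f v = 1 \<or> f v = -1" "B u v = 1 \<or> B u v = -1"
        using f1 off[of u v] S by blast+
      then show "f u * f v * B u v \<le> 1" by auto
    qed
    also have "\<dots> = real t - 1"
      using S t by (simp add: of_nat_diff)
    finally show ?thesis by simp
  qed
  \<comment> \<open>The part of \<open>u\<close> contributes at most \<open>D + t - 1\<close> and
    each of the other two exactly \<open>-t\<close>, in total at most
    \<open>D - 1 - t < 0\<close>.\<close>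
  have row: "(\<Sum>v\<in>?U. f u * f v * B u v) < 0" if u: "u \<in> ?U" for u
  proof -
    have split: "(\<Sum>v\<in>?U. f u * f v * B u v)
        = (\<Sum>v\<in>X'. f u * f v * B u v) + (\<Sum>v\<in>Y'. f u * f v * B u v) + (\<Sum>v\<in>Z'. f u * f v * B u v)"
      using disj X' Y' Z' by (simp add: sum.union_disjoint Int_Un_distrib2)
    consider "u \<in> X'" | "u \<in> Y'" | "u \<in> Z'" using u by blast
    then show ?thesis
    proof cases
      case 1
      then have "(\<Sum>v\<in>X'. f u * f v * B u v) \<le> D + (real t - 1)"
        using X' by (intro same) auto
      with 1 Y' Z' t show ?thesis by (simp add: split xy xz)
    next
      case 2
      have "(\<Sum>v\<in>X'. f u * f v * B u v) = - real t"
        using 2 X' by (simp add: yx)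
      moreover have "(\<Sum>v\<in>Y'. f u * f v * B u v) \<le> D + (real t - 1)"
        using 2 Y' by (intro same) auto
      ultimately show ?thesis using 2 Z' t by (simp add: split yz)
    next
      case 3
      have "(\<Sum>v\<in>X'. f u * f v * B u v) = - real t" "(\<Sum>v\<in>Y'. f u * f v * B u v) = - real t"
        using 3 X' Y' by (simp_all add: zx zy)
      moreover have "(\<Sum>v\<in>Z'. f u * f v * B u v) \<le> D + (real t - 1)"
        using 3 Z' by (intro same) auto
      ultimately show ?thesis using t by (simp add: split)
    qed
  qed
  have "0 \<le> (\<Sum>u\<in>V. \<Sum>v\<in>V. f u * f v * B u v)" by (rule psd)
  also have "\<dots> = (\<Sum>u\<in>?U. \<Sum>v\<in>V. f u * f v * B u v)"
    using U V by (intro sum.mono_neutral_right) (auto simp: f_def)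
  also have "\<dots> = (\<Sum>u\<in>?U. \<Sum>v\<in>?U. f u * f v * B u v)"
    using U V by (intro sum.cong refl sum.mono_neutral_right) (auto simp: f_def)
  also have "\<dots> < (\<Sum>u\<in>?U. 0)"
    using U pts row by (intro sum_strict_mono) auto
  finally show False by simp
qed

section \<open>From a vertex with few negative triples to a balanced cut and a labeling\<close>

text \<open>These are the disagreements with the complete bipartite graph between \<open>P\<close>
  and \<open>V - P\<close>. Ordered pairs count each one twice, which is harmless for upper
  bounds.\<close>

definition cut_defects :: "'a set \<Rightarrow> 'a set set \<Rightarrow> 'a set \<Rightarrow> ('a \<times> 'a) set" where
  "cut_defects V E P = {(u, v) \<in> V \<times> V. u \<noteq> v \<and> ({u, v} \<in> E \<longleftrightarrow> (u \<in> P \<longleftrightarrow> v \<in> P))}"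

text \<open>Label \<open>P\<close> and one side of the bipartite graph by the numbers below
  \<open>h\<close>, and the rest by those from \<open>h\<close> to \<open>2 * h - 1\<close>. Every
  edge on which the labeled graphs differ is then the image of a defect.\<close>

lemma relabel_complete_bipartite:
  assumes G: "simple_graph V E" and card: "card V = 2 * h" and P: "P \<subseteq> V" "card P = h"
  obtains L :: "nat set" and f g where "bij_betw f V L"
    "bij_betw g (complete_bipartite_vertices h h) L"
    "card (sym_diff (relabel f E) (relabel g (complete_bipartite_edges h h))) \<le> card (cut_defects V E P)"
proof -
  interpret simple_graph V E by fact
  note V = finite_vertices
  have cP: "card (V - P) = h"
    using V P card by (simp add: card_Diff_subset finite_subset)
  obtain f1 where f1: "bij_betw f1 P {..<h}"
    using finite_same_card_bij[of P "{..<h}"] P V finite_subset by auto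
  obtain f2 where f2: "bij_betw f2 (V - P) {h..<2 * h}"
    using finite_same_card_bij[of "V - P" "{h..<2 * h}"] cP V by auto
  define f where "f = (\<lambda>v. if v \<in> P then f1 v else f2 v)"
  define g where "g = case_sum (\<lambda>i. i) (\<lambda>j :: nat. h + j)"
  have fP: "bij_betw f P {..<h}"
    using f1 by (rule bij_betw_cong[THEN iffD1, rotated]) (simp add: f_def)
  have fQ: "bij_betw f (V - P) {h..<2 * h}"
    using f2 by (rule bij_betw_cong[THEN iffD1, rotated]) (simp add: f_def)
  have "bij_betw f (P \<union> (V - P)) ({..<h} \<union> {h..<2 * h})"
    by (rule bij_betw_combine[OF fP fQ]) auto
  moreover have "P \<union> (V - P) = V" "{..<h} \<union> {h..<2 * h} = {..<2 * h}"
    using P by auto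
  ultimately have f: "bij_betw f V {..<2 * h}" by simp
  have g: "bij_betw g (complete_bipartite_vertices h h) {..<2 * h}"
    by (rule bij_betw_byWitness[where f' = "\<lambda>i. if i < h then Inl i else Inr (i - h)"])
      (auto simp: g_def complete_bipartite_vertices_def)
  have gi: "g ` {Inl i, Inr j} = {i, h + j}" for i j
    by (simp add: g_def)
  have crossing: "{f u, f v} \<in> relabel g (complete_bipartite_edges h h)"
    if "u \<in> P" "v \<in> V - P" for u v
  proof -
    have "f u < h" "h \<le> f v" "f v < 2 * h"
      using bij_betwE[OF fP] bij_betwE[OF fQ] that by auto
    then have "f u < h \<and> f v - h < h" "{f u, f v} = g ` {Inl (f u), Inr (f v - h)}"
      unfolding gi by auto
    moreover from this(1) have "{Inl (f u), Inr (f v - h)} \<in> complete_bipartite_edges h h"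
      unfolding complete_bipartite_edges_def by blast
    ultimately show ?thesis
      unfolding relabel_def by blast
  qed
  have "sym_diff (relabel f E) (relabel g (complete_bipartite_edges h h))
      \<subseteq> (\<lambda>(u, v). {f u, f v}) ` cut_defects V E P"
  proof
    fix e assume "e \<in> sym_diff (relabel f E) (relabel g (complete_bipartite_edges h h))"
    then consider (left) "e \<in> relabel f E" "e \<notin> relabel g (complete_bipartite_edges h h)"
      | (right) "e \<in> relabel g (complete_bipartite_edges h h)" "e \<notin> relabel f E" by blast
    then show "e \<in> (\<lambda>(u, v). {f u, f v}) ` cut_defects V E P"
    proof cases
      case left
      then obtain e' where e': "e' \<in> E" "e = f ` e'"
        by (auto simp: relabel_def)
      then have "e' \<subseteq> V" "card e' = 2"
        using edges_subset by auto
      then obtain u v where uv: "e' = {u, v}" "u \<noteq> v" "u \<in> V" "v \<in> V"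
        by (auto simp: card_2_iff)
      with e' have e: "e = {f u, f v}" by auto
      have "u \<in> P \<longleftrightarrow> v \<in> P"
        using left(2) crossing[of u v] crossing[of v u] uv by (auto simp: e insert_commute)
      then have "(u, v) \<in> cut_defects V E P"
        using e' uv by (simp add: cut_defects_def)
      then show ?thesis
        using e by force
    next
      case right
      then obtain i j where ij: "i < h" "j < h" "e = {i, h + j}"
        by (auto simp: relabel_def complete_bipartite_edges_def g_def)
      obtain u where u: "u \<in> P" "f u = i"
        using bij_betw_imp_surj_on[OF fP] ij(1) by (metis imageE lessThan_iff)
      have "h + j \<in> f ` (V - P)"
        using fQ ij by (simp add: bij_betw_def)
      then obtain v where v: "v \<in> V - P" "f v = h + j"
        by auto
      have e: "e = {f u, f v}"
        using ij u v by simp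
      have "{u, v} \<notin> E"
      proof
        assume "{u, v} \<in> E"
        then have "f ` {u, v} \<in> relabel f E"
          unfolding relabel_def by (rule imageI)
        with right(2) e show False by simp
      qed
      then have "(u, v) \<in> cut_defects V E P"
        using u v P by (auto simp: cut_defects_def)
      then show ?thesis
        using e by force
    qed
  qed
  moreover have "finite (cut_defects V E P)"
    using V by (auto intro: finite_subset[of _ "V \<times> V"] simp: cut_defects_def)
  ultimately have "card (sym_diff (relabel f E) (relabel g (complete_bipartite_edges h h)))
      \<le> card (cut_defects V E P)"
    by (meson card_image_le card_mono finite_imageI order_trans)
  with f g show thesis
    by (rule that)
qed

text \<open>This is the link of \<open>a\<close> in the system of negative triples, with ordered
  pairs.\<close>

definition negative_pairs :: "'a set \<Rightarrow> ('a \<Rightarrow> 'a \<Rightarrow> real) \<Rightarrow> 'a \<Rightarrow> ('a \<times> 'a) set" where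
  "negative_pairs V B a = {(u, v) \<in> V \<times> V. distinct [a, u, v] \<and> B a u * B u v * B a v = -1}"

text \<open>
  The cut is given by the signs \<open>s v = B a v\<close>. As every row of \<open>J - 2 A\<close> sums to zero, \<open>(\<Sum>v. s v)\<^sup>2\<close> is at
  most twice the number of pairs with \<open>B u v \<noteq> s u s v\<close>, so that the cut is nearly balanced.
\<close>

lemma balanced_cut_with_few_defects:
  fixes \<gamma> :: real
  assumes G: "simple_graph V E" and reg: "regular_graph V E (card V div 2)" and even: "even (card V)"
    and a: "a \<in> V" and \<gamma>: "\<gamma> > 0"
    and few: "card (negative_pairs V (shifted_seidel D E) a) \<le> \<gamma>\<^sup>2 / 2 * real (card V) ^ 2"
  obtains P where "P \<subseteq> V" "card P = card V div 2"
    "card (cut_defects V E P) \<le> (\<gamma>\<^sup>2 / 2 + \<gamma>) * real (card V) ^ 2"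
proof -
  interpret simple_graph V E by fact
  note V = finite_vertices
  let ?B = "shifted_seidel D E"
  define n where "n = card V"
  define h where "h = n div 2"
  have n: "n = 2 * h" using even by (simp add: n_def h_def)
  \<comment> \<open>The diagonal entry at \<open>a\<close> is \<open>D\<close> rather than a sign,
    so \<open>a\<close> is given sign 1 separately; pairs containing \<open>a\<close> are then never
    bad.\<close>
  define s where "s = (\<lambda>v. if v = a then 1 else ?B a v)"
  have s: "s v = 1 \<or> s v = -1" for v
    by (simp add: s_def shifted_seidel_def)
  define bad where "bad = {(u, v) \<in> V \<times> V. u \<noteq> v \<and> ?B u v \<noteq> s u * s v}"
  have "bad \<subseteq> negative_pairs V ?B a"
    by (auto simp: bad_def negative_pairs_def s_def shifted_seidel_def insert_commute split: if_splits)
  then have "card bad \<le> card (negative_pairs V ?B a)"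
    using V by (intro card_mono) (auto simp: negative_pairs_def intro: finite_subset[of _ "V \<times> V"])
  with few have bad: "card bad \<le> \<gamma>\<^sup>2 / 2 * real n ^ 2"
    unfolding n_def by linarith
  have fin_bad: "finite bad"
    using V by (auto intro: finite_subset[of _ "V \<times> V"] simp: bad_def)
  define P0 where "P0 = {v \<in> V. s v = 1}"
  have P0: "P0 \<subseteq> V" by (auto simp: P0_def)
  have sum_s: "(\<Sum>v\<in>V. s v) = 2 * real (card P0) - n"
  proof -
    have "(\<Sum>v\<in>V. s v) = (\<Sum>v\<in>V. 2 * (if v \<in> P0 then 1 else 0) - 1)"
      using s by (intro sum.cong) (auto simp: P0_def)
    also have "\<dots> = 2 * real (card P0) - n"
      using V P0 by (simp add: sum_subtractf n_def sum.If_cases Int_absorb1 Int_absorb2 flip: sum_distrib_left)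
    finally show ?thesis .
  qed
  \<comment> \<open>Diagonal 1 yields exactly \<open>J - 2 A\<close>. The entries off the diagonal
    do not depend on this choice, so \<open>bad\<close> also measures the distance from
    \<open>J - 2 A\<close>.\<close>
  have row: "(\<Sum>v\<in>V. shifted_seidel 1 E u v) = 0" if "u \<in> V" for u
  proof -
    have "(\<Sum>v\<in>V. shifted_seidel 1 E u v) = (\<Sum>v\<in>V. 1 - 2 * (if {u, v} \<in> E then 1 else 0))"
      using no_loops[OF G] by (intro sum.cong) (auto simp: shifted_seidel_def)
    also have "\<dots> = real n - 2 * real (degree_in E u)"
      using sum_neighbours[OF G that] by (simp add: sum_subtractf n_def flip: sum_distrib_left)
    finally show ?thesis
      using reg that n by (simp add: regular_graph_def h_def n_def)
  qed
  have "(\<Sum>v\<in>V. s v)\<^sup>2 = (\<Sum>u\<in>V. \<Sum>v\<in>V. s u * s v)"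
    by (simp add: power2_eq_square sum_product)
  also have "\<dots> \<le> (\<Sum>u\<in>V. \<Sum>v\<in>V. shifted_seidel 1 E u v + 2 * (if (u, v) \<in> bad then 1 else 0))"
  proof (intro sum_mono)
    fix u v assume "u \<in> V" "v \<in> V"
    have "s u * s v = 1 \<or> s u * s v = -1" "u = v \<Longrightarrow> s u * s v = 1"
      using s[of u] s[of v] by auto
    with \<open>u \<in> V\<close> \<open>v \<in> V\<close>
    show "s u * s v \<le> shifted_seidel 1 E u v + 2 * (if (u, v) \<in> bad then 1 else 0)"
      unfolding bad_def shifted_seidel_def by (cases "u = v"; cases "{u, v} \<in> E") auto
  qed
  also have "\<dots> = 2 * (\<Sum>u\<in>V. \<Sum>v\<in>V. if (u, v) \<in> bad then 1 else 0)"
    by (simp add: sum.distrib row flip: sum_distrib_left)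
  also have "(\<Sum>u\<in>V. \<Sum>v\<in>V. if (u, v) \<in> bad then 1 else 0) = (\<Sum>p\<in>V \<times> V. if p \<in> bad then 1 else 0 :: real)"
    by (simp add: sum.cartesian_product)
  also have "\<dots> = card bad"
  proof -
    have "V \<times> V \<inter> bad = bad" by (auto simp: bad_def)
    then show ?thesis using V by (simp add: sum.If_cases)
  qed
  \<comment> \<open>The squared sum is at most \<open>2 * card bad\<close>; this is why the
    hypothesis allows \<open>\<gamma>\<^sup>2 / 2\<close> as density.\<close>
  finally have "(2 * real (card P0) - n)\<^sup>2 \<le> (\<gamma> * n)\<^sup>2"
    using bad by (simp add: sum_s power_mult_distrib)
  then have "\<bar>2 * real (card P0) - n\<bar> \<le> \<gamma> * n"
    unfolding abs_le_square_iff[symmetric] using \<gamma> by (simp add: abs_mult)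
  then have near: "\<bar>real (card P0) - h\<bar> \<le> \<gamma> * n / 2"
    using n by simp
  obtain P where P: "P \<subseteq> V" "card P = h" "real (card (sym_diff P0 P)) = \<bar>real (card P0) - h\<bar>"
  proof (cases "card P0 \<le> h")
    case True
    then obtain P where P: "P0 \<subseteq> P" "P \<subseteq> V" "card P = h"
      using exists_subset_between[of P0 h V] P0 V n by (auto simp: n_def)
    then have "sym_diff P0 P = P - P0" by auto
    then have "card (sym_diff P0 P) = h - card P0"
      using P P0 V by (simp add: card_Diff_subset finite_subset)
    with P True show thesis
      by (intro that[of P]) (auto simp: of_nat_diff)
  next
    case False
    then obtain P where P: "P \<subseteq> P0" "card P = h"
      using obtain_subset_with_card_n[of h P0] by auto
    then have "sym_diff P0 P = P0 - P" by auto
    then have "card (sym_diff P0 P) = card P0 - h"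
      using P P0 V by (metis card_Diff_subset finite_subset)
    with P P0 False show thesis
      by (intro that[of P]) (auto simp: of_nat_diff)
  qed
  \<comment> \<open>A defect of \<open>P\<close> that avoids the moved vertices is bad. At most
    \<open>\<gamma> * n / 2\<close> vertices are moved, so at most
    \<open>\<gamma> * n\<^sup>2\<close> ordered pairs contain one.\<close>
  have "cut_defects V E P \<subseteq> bad \<union> (sym_diff P0 P \<times> V \<union> V \<times> sym_diff P0 P)"
  proof
    fix p assume "p \<in> cut_defects V E P"
    then obtain u v where p: "p = (u, v)" "u \<in> V" "v \<in> V" "u \<noteq> v"
      "{u, v} \<in> E \<longleftrightarrow> (u \<in> P \<longleftrightarrow> v \<in> P)"
      by (auto simp: cut_defects_def)
    show "p \<in> bad \<union> (sym_diff P0 P \<times> V \<union> V \<times> sym_diff P0 P)"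
    proof (cases "u \<in> sym_diff P0 P \<or> v \<in> sym_diff P0 P")
      case False
      then have iff: "u \<in> P \<longleftrightarrow> s u = 1" "v \<in> P \<longleftrightarrow> s v = 1"
        using p(2,3) unfolding P0_def by blast+
      have "s u * s v = (if u \<in> P \<longleftrightarrow> v \<in> P then 1 else -1)"
        unfolding iff using s[of u] s[of v] by (elim disjE) simp_all
      then have "(u, v) \<in> bad"
        using p unfolding bad_def shifted_seidel_def by simp
      then show ?thesis using p by simp
    qed (use p in auto)
  qed
  moreover have finD: "finite (sym_diff P0 P)"
    using P P0 V by (meson finite_Diff finite_UnI finite_subset)
  ultimately have "card (cut_defects V E P) \<le> card (bad \<union> (sym_diff P0 P \<times> V \<union> V \<times> sym_diff P0 P))"
    using V fin_bad by (intro card_mono) auto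
  also have "\<dots> \<le> card bad + (card (sym_diff P0 P \<times> V) + card (V \<times> sym_diff P0 P))"
    by (meson add_left_mono card_Un_le order_trans)
  also have "\<dots> = card bad + 2 * (card (sym_diff P0 P) * n)"
    by (simp add: card_cartesian_product n_def)
  finally have "card (cut_defects V E P) \<le> card bad + 2 * (card (sym_diff P0 P) * n)" .
  then have "real (card (cut_defects V E P)) \<le> real (card bad) + 2 * (real (card (sym_diff P0 P)) * n)"
    by (metis (no_types, lifting) of_nat_add of_nat_le_iff of_nat_mult of_nat_numeral)
  also have "\<dots> \<le> \<gamma>\<^sup>2 / 2 * real n ^ 2 + 2 * (\<gamma> * n / 2 * n)"
    using bad near P(3) by (intro add_mono mult_left_mono mult_right_mono) auto
  also have "\<dots> = (\<gamma>\<^sup>2 / 2 + \<gamma>) * real n ^ 2"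
    by (simp add: algebra_simps power2_eq_square)
  finally show thesis
    using P by (intro that[of P]) (auto simp: n_def h_def)
qed

section \<open>Closeness to the complete bipartite graph for all large \<open>n\<close>\<close>

theorem theorem5:
  fixes c \<epsilon> :: real
  assumes "\<epsilon> > 0"
  shows "\<exists>N :: nat. \<forall>n \<ge> N. \<forall>(V :: 'a set) (E :: 'a set set).
    simple_graph V E \<longrightarrow> card V = n \<longrightarrow> even n \<longrightarrow> regular_graph V E (n div 2) \<longrightarrow>
    graph_eigenvalue V E 2 \<le> c \<longrightarrow>
    (\<exists>(L :: nat set) f g.
       bij_betw f V L \<and>
       bij_betw g (complete_bipartite_vertices (n div 2) (n div 2)) L \<and>
       real (card (sym_diff (relabel f E)
         (relabel g (complete_bipartite_edges (n div 2) (n div 2))))) \<le> \<epsilon> * real n ^ 2)"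
proof -
  \<comment> \<open>The semidefiniteness argument needs a nonnegative eigenvalue bound, and raising
    \<open>c\<close> to 0 keeps it valid.\<close>
  define C where "C = max c 0"
  define D where "D = 2 * C + 1"
  define t where "t = Suc (nat \<lceil>D\<rceil>)"
  have t: "t > 0" "D \<le> real t"
    unfolding t_def by (simp, linarith)
  \<comment> \<open>The cap 1 gives \<open>\<gamma>\<^sup>2 \<le> \<gamma>\<close>, so the final
    density is at most \<open>3 / 2 * \<gamma>\<close>, which is below
    \<open>\<epsilon>\<close>.\<close>
  define \<gamma> where "\<gamma> = min 1 (\<epsilon> / 2)"
  have \<gamma>: "\<gamma> > 0" "\<gamma> \<le> 1" "\<gamma> \<le> \<epsilon> / 2"
    using assms by (auto simp: \<gamma>_def)
  have "\<gamma>\<^sup>2 \<le> \<gamma>"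
    using \<gamma> by (simp add: power2_eq_square mult_left_le)
  then have \<gamma>\<epsilon>: "\<gamma>\<^sup>2 / 2 + \<gamma> \<le> \<epsilon>"
    using \<gamma> by linarith
  have "\<gamma>\<^sup>2 / 2 > 0" using \<gamma> by simp
  from complete_tripartite_subsystem[OF this, where ?'a = 'a and t = t]
  obtain N0 where N0: "\<And>(V :: 'a set) T. finite V \<Longrightarrow> N0 \<le> card V \<Longrightarrow>
    (\<And>a. a \<in> V \<Longrightarrow> \<gamma>\<^sup>2 / 2 * real (card V) ^ 2 \<le> card {(y, z) \<in> V \<times> V. T a y z}) \<Longrightarrow>
    \<exists>X Y Z. X \<subseteq> V \<and> Y \<subseteq> V \<and> Z \<subseteq> V \<and> t \<le> card X \<and> t \<le> card Y \<and> t \<le> card Z \<and>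
      (\<forall>x\<in>X. \<forall>y\<in>Y. \<forall>z\<in>Z. T x y z)"
    by blast
  \<comment> \<open>Besides \<open>N0\<close>, the size must exceed \<open>2 * C\<close>, so that
    the eigenvalue \<open>n/2\<close> lies above the bound on the second one.\<close>
  define N where "N = Suc (N0 + nat \<lceil>2 * C\<rceil>)"
  show ?thesis
  proof (intro exI[of _ N] allI impI)
    fix n and V :: "'a set" and E
    assume "N \<le> n" and G: "simple_graph V E" and n: "card V = n" and even: "even n"
      and reg: "regular_graph V E (n div 2)" and eig: "graph_eigenvalue V E 2 \<le> c"
    note V = simple_graph.finite_vertices[OF G]
    let ?B = "shifted_seidel D E"
    have "2 * C < real N"
      unfolding N_def by linarith
    then have "2 * C < real n"
      using \<open>N \<le> n\<close> by linarith
    then have psd: "0 \<le> (\<Sum>u\<in>V. \<Sum>v\<in>V. f u * f v * ?B u v)" for f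
      unfolding D_def using G reg even eig n by (intro shifted_seidel_psd) (auto simp: C_def)
    have "\<exists>a\<in>V. card (negative_pairs V ?B a) < \<gamma>\<^sup>2 / 2 * real (card V) ^ 2"
    proof (rule ccontr)
      assume "\<not> ?thesis"
      then have "\<gamma>\<^sup>2 / 2 * real (card V) ^ 2 \<le> card (negative_pairs V ?B a)" if "a \<in> V" for a
        using that by force
      then have "\<exists>X Y Z. X \<subseteq> V \<and> Y \<subseteq> V \<and> Z \<subseteq> V \<and> t \<le> card X \<and> t \<le> card Y \<and> t \<le> card Z \<and>
          (\<forall>x\<in>X. \<forall>y\<in>Y. \<forall>z\<in>Z. distinct [x, y, z] \<and> ?B x y * ?B y z * ?B x z = -1)"
        using \<open>N \<le> n\<close> n V by (intro N0) (auto simp: N_def negative_pairs_def)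
      then obtain X Y Z where XYZ: "X \<subseteq> V" "Y \<subseteq> V" "Z \<subseteq> V" "t \<le> card X" "t \<le> card Y" "t \<le> card Z"
        "\<forall>x\<in>X. \<forall>y\<in>Y. \<forall>z\<in>Z. distinct [x, y, z] \<and> ?B x y * ?B y z * ?B x z = -1"
        by blast
      have "?B u v = ?B v u" "?B v v = D" "u \<noteq> v \<Longrightarrow> ?B u v = 1 \<or> ?B u v = -1" for u v
        by (auto simp: shifted_seidel_def insert_commute)
      from no_complete_tripartite_negative_system[OF V this psd XYZ(1-6) t] XYZ(7) show False
        by blast
    qed
    then obtain a where a: "a \<in> V" "card (negative_pairs V ?B a) \<le> \<gamma>\<^sup>2 / 2 * real (card V) ^ 2"
      by force
    obtain P where P: "P \<subseteq> V" "card P = card V div 2"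
      "card (cut_defects V E P) \<le> (\<gamma>\<^sup>2 / 2 + \<gamma>) * real (card V) ^ 2"
      using balanced_cut_with_few_defects[OF G _ _ a(1) \<gamma>(1) a(2)] reg even n by blast
    have "card V = 2 * (n div 2)"
      using even n by simp
    then obtain L :: "nat set" and f g where fg: "bij_betw f V L"
      "bij_betw g (complete_bipartite_vertices (n div 2) (n div 2)) L"
      "card (sym_diff (relabel f E) (relabel g (complete_bipartite_edges (n div 2) (n div 2))))
        \<le> card (cut_defects V E P)"
      using relabel_complete_bipartite[OF G _ P(1)] P(2) n by metis
    have "real (card (cut_defects V E P)) \<le> \<epsilon> * real n ^ 2"
      using P(3) \<gamma>\<epsilon> n by (meson mult_right_mono order_trans zero_le_power2)
    with fg show "\<exists>(L :: nat set) f g.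
       bij_betw f V L \<and>
       bij_betw g (complete_bipartite_vertices (n div 2) (n div 2)) L \<and>
       real (card (sym_diff (relabel f E)
         (relabel g (complete_bipartite_edges (n div 2) (n div 2))))) \<le> \<epsilon> * real n ^ 2"
      by (intro exI[of _ L] exI[of _ f] exI[of _ g]) auto
  qed
qed

end
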